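(* Let $p$ be a prime and let $G$ be a finite nonabelian $p$-group. Let $\mu$ be the Möbius function of the poset $\{\mathbf{Z}(\mathbf{C}_G(g)) \mid g\in G\}$ ordered by containment. Then for each $H\in\mathfrak{C}(G)\setminus\{G\}$ we have $$\sum_{\substack{H\subseteq \mathbf{C}_G(g),\\ \mathbf{C}_G(g)\subset G}} \mu(\mathbf{Z}(\mathbf{C}_G(g))) \equiv -1 \pmod p,$$ where the sum runs over the distinct subgroups of the form $\mathbf{C}_G(g)$, $g\in G$, that contain $H$ and are properly contained in $G$ (each such subgroup being counted once).
   Context: For a subset $S$ of a group $G$, $\mathbf{C}_G(S)=\{x\in G\mid xs=sx \text{ for all } s\in S\}$, with $\mathbf{C}_G(\emptyset)=G$, and $\mathbf{C}_G(g)=\mathbf{C}_G(\{g\})$. $\mathbf{Z}(K)$ denotes the center of a group $K$. $\mathfrak{C}(G)=\{\mathbf{C}_G(S)\mid S\subseteq G\}$ is the set of all centralizers of subsets of $G$ (the centralizer lattice of $G$). The symbol $\subset$ denotes proper containment. For a finite poset $\mathcal{P}$ with unique minimal element $\hat 0$, the Möbius function $\mu:\mathcal{P}\to\mathbb{Z}$ is defined recursively by $\mu(\hat 0)=1$ and $\mu(x)=-\sum_{y<x}\mu(y)$ for $x>\hat 0$. The poset $\{\mathbf{Z}(\mathbf{C}_G(g))\mid g\in G\}$ has unique minimal element $\mathbf{Z}(G)$. *)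

theory Defs
  imports "HOL-Algebra.Algebra" "HOL-Number_Theory.Cong"
begin

definition centralizer :: "('a, 'b) monoid_scheme \<Rightarrow> 'a set \<Rightarrow> 'a set" where
  "centralizer G S = {x \<in> carrier G. \<forall>s\<in>S. x \<otimes>\<^bsub>G\<^esub> s = s \<otimes>\<^bsub>G\<^esub> x}"

definition centralizer_lattice :: "('a, 'b) monoid_scheme \<Rightarrow> 'a set set" where
  "centralizer_lattice G = {centralizer G S | S. S \<subseteq> carrier G}"

definition element_centralizers :: "('a, 'b) monoid_scheme \<Rightarrow> 'a set set" where
  "element_centralizers G = {centralizer G {g} | g. g \<in> carrier G}"

definition center :: "('a, 'b) monoid_scheme \<Rightarrow> 'a set" where
  "center K = {z \<in> carrier K. \<forall>x\<in>carrier K. z \<otimes>\<^bsub>K\<^esub> x = x \<otimes>\<^bsub>K\<^esub> z}"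

definition element_centralizer_centers :: "('a, 'b) monoid_scheme \<Rightarrow> 'a set set" where
  "element_centralizer_centers G =
     {center (G\<lparr>carrier := centralizer G {g}\<rparr>) | g. g \<in> carrier G}"

text \<open>The Moebius function of a finite poset \<open>P\<close> with least element, carried by a subset of an
  ordered type. The value 0 off \<open>P\<close>, or for infinite \<open>P\<close>, is a convention.\<close>

function moebius :: "'a::order set \<Rightarrow> 'a \<Rightarrow> int" where
  "moebius P x =
     (if finite P \<and> x \<in> P
      then if \<forall>y\<in>P. x \<le> y then 1 else - (\<Sum>y\<in>{y \<in> P. y < x}. moebius P y)
      else 0)"
  by pat_completeness auto
termination
proof (relation "measure (\<lambda>(P, x). card {y \<in> P. y < x})")
  show "((P, y), (P, x)) \<in> measure (\<lambda>(P, x). card {y \<in> P. y < x})"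
    if "finite P \<and> x \<in> P" "y \<in> {y \<in> P. y < x}" for P :: "'a set" and x y
  proof -
    have "{z \<in> P. z < y} \<subset> {z \<in> P. z < x}"
      using that by (auto intro: less_trans)
    then show ?thesis
      using that by (simp add: psubset_card_mono)
  qed
qed simp

declare moebius.simps [simp del]

lemma moebius_least:
  assumes "finite P" "b \<in> P" "\<And>y. y \<in> P \<Longrightarrow> b \<le> y"
  shows "moebius P b = 1"
  using assms by (simp add: moebius.simps[of P b])

lemma moebius_rec:
  assumes "finite P" "b \<in> P" "\<And>y. y \<in> P \<Longrightarrow> b \<le> y" "x \<in> P" "b < x"
  shows "moebius P x = - (\<Sum>y\<in>{y \<in> P. y < x}. moebius P y)"
  using assms by (subst moebius.simps) (auto dest: leD)

lemma (in group) center_in_element_centralizer_centers: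
  "center G \<in> element_centralizer_centers G"
proof -
  have "centralizer G {\<one>} = carrier G"
    by (auto simp: centralizer_def)
  then have "center G = center (G\<lparr>carrier := centralizer G {\<one>}\<rparr>)"
    by (simp add: center_def)
  then show ?thesis
    unfolding element_centralizer_centers_def by blast
qed

lemma (in group) center_least:
  "A \<in> element_centralizer_centers G \<Longrightarrow> center G \<subseteq> A"
  by (auto simp: element_centralizer_centers_def center_def centralizer_def)

end

theory Submission
  imports Defs
begin

text \<open>Write \<open>C\<close> for the centralizer operator, so that \<open>C (C S)\<close> is a closure operator on subsets
  of \<open>G\<close>. Since \<open>g \<in> C {g}\<close>, the centre of \<open>C {g}\<close> is \<open>C (C {g})\<close>, the closure of the single
  element \<open>g\<close>. The poset in question therefore consists of the closures of single elements, and
  sending a group element to its closure cuts every closed subgroup \<open>A\<close> into pieces: the elements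
  of \<open>A\<close> are counted, without repetition, by the members \<open>Y \<subseteq> A\<close> of the poset, each contributing
  the number \<open>f Y\<close> of elements whose closure is exactly \<open>Y\<close>.

  Let \<open>z\<close> be the order of the centre of \<open>G\<close>. In a \<open>p\<close>-group every subgroup strictly above the
  centre has order divisible by \<open>p * z\<close>. Hence modulo \<open>p * z\<close> the numbers \<open>f Y\<close> have the
  value \<open>z\<close> at the bottom and sum to \<open>0\<close> over each nontrivial principal ideal of the poset. This is
  the recursion for \<open>z * \<mu>\<close>, so \<open>f Y \<equiv> z * \<mu> Y\<close> (\<open>moebius_cong_counting\<close>). Summing over the members
  inside \<open>A = C H\<close>, which lies strictly above the centre because \<open>H \<noteq> G\<close>, gives
  \<open>z * (\<Sum>Y\<subseteq>A. \<mu> Y) \<equiv> card A \<equiv> 0\<close> modulo \<open>p * z\<close>, so the sum of \<open>\<mu>\<close> itself vanishes modulo \<open>p\<close>.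
  The bottom contributes \<open>1\<close>, and the remaining members correspond through \<open>C\<close> to the
  element centralizers \<open>K\<close> with \<open>H \<subseteq> K \<subset> G\<close>.\<close>

text \<open>The values \<open>f x\<close> are determined modulo \<open>m\<close> by their sums over principal ideals; when those sums
  vanish away from the bottom, \<open>f\<close> obeys the recursion that defines the Moebius function, up to the
  factor \<open>f b\<close>.\<close>

lemma moebius_cong_counting:
  fixes P :: "'c::order set" and f :: "'c \<Rightarrow> int"
  assumes fin: "finite P" and b: "b \<in> P" "\<And>y. y \<in> P \<Longrightarrow> b \<le> y"
    and ideal_sums: "\<And>x. x \<in> P \<Longrightarrow> x \<noteq> b \<Longrightarrow> [(\<Sum>y\<in>{y \<in> P. y \<le> x}. f y) = 0] (mod m)"
    and "x \<in> P"
  shows "[f x = f b * moebius P x] (mod m)"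
  using \<open>x \<in> P\<close>
proof (induction "card {y \<in> P. y < x}" arbitrary: x rule: less_induct)
  case less
  show ?case
  proof (cases "x = b")
    case True
    then show ?thesis
      using moebius_least[OF fin b] by simp
  next
    case False
    let ?below = "{y \<in> P. y < x}"
    have IH: "[f y = f b * moebius P y] (mod m)" if "y \<in> ?below" for y
    proof (rule less.hyps)
      have "{w \<in> P. w < y} \<subset> ?below"
        using that by (auto intro: less_trans)
      then show "card {w \<in> P. w < y} < card ?below"
        using fin by (simp add: psubset_card_mono)
      show "y \<in> P"
        using that by simp
    qed
    have "b < x"
      using b(2)[OF less.prems] False by simp
    then have rec: "moebius P x = - (\<Sum>y\<in>?below. moebius P y)"
      using moebius_rec[OF fin b less.prems] by simp
    have "{y \<in> P. y \<le> x} = insert x ?below"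
      using less.prems by auto
    then have "(\<Sum>y\<in>{y \<in> P. y \<le> x}. f y) = f x + (\<Sum>y\<in>?below. f y)"
      using fin by simp
    then have "[f x + (\<Sum>y\<in>?below. f y) = 0] (mod m)"
      using ideal_sums[OF less.prems False] by simp
    from cong_diff[OF this cong_sum[OF IH, of ?below "\<lambda>y. y"]]
    show ?thesis
      by (simp add: rec sum_distrib_left)
  qed
qed

text \<open>The divisibility behind the whole argument: orders of nested subgroups of a \<open>p\<close>-group are
  powers of \<open>p\<close>, so a proper inclusion costs at least one factor \<open>p\<close>.\<close>

lemma (in group) p_group_proper_subgroup_card_dvd:
  assumes p: "Factorial_Ring.prime (p::nat)" and fin: "finite (carrier G)" and ord: "order G = p ^ n"
    and sub: "subgroup A G" "subgroup B G" and "A \<subset> B"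
  shows "p * card A dvd card B"
proof -
  have "card A dvd p ^ n" "card B dvd p ^ n"
    using sub lagrange[of A] lagrange[of B] ord by (metis dvd_triv_right)+
  then obtain i j where ij: "card A = p ^ i" "card B = p ^ j"
    using p by (meson divides_primepow_nat)
  have "finite B"
    using fin sub(2) finite_subset subgroup.subset by blast
  then have "card A < card B"
    using \<open>A \<subset> B\<close> by (rule psubset_card_mono)
  then have "i < j"
    unfolding ij by (rule power_less_imp_less_exp[OF prime_gt_1_nat[OF p]])
  then have "p ^ Suc i dvd p ^ j"
    by (intro le_imp_power_dvd) simp
  then show ?thesis
    using ij by simp
qed

lemma centralizer_antimono: "S \<subseteq> T \<Longrightarrow> centralizer G T \<subseteq> centralizer G S"
  by (auto simp: centralizer_def)

lemma centralizer_subset_carrier: "centralizer G S \<subseteq> carrier G"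
  by (auto simp: centralizer_def)

lemma subset_double_centralizer:
  "S \<subseteq> carrier G \<Longrightarrow> S \<subseteq> centralizer G (centralizer G S)"
  by (auto simp: centralizer_def)

lemma triple_centralizer:
  assumes "S \<subseteq> carrier G"
  shows "centralizer G (centralizer G (centralizer G S)) = centralizer G S"
proof
  show "centralizer G (centralizer G (centralizer G S)) \<subseteq> centralizer G S"
    using subset_double_centralizer[OF assms] by (rule centralizer_antimono)
  show "centralizer G S \<subseteq> centralizer G (centralizer G (centralizer G S))"
    by (rule subset_double_centralizer[OF centralizer_subset_carrier])
qed

lemma (in group) centralizer_subgroup:
  assumes "S \<subseteq> carrier G"
  shows "subgroup (centralizer G S) G"
proof (rule subgroupI)
  show "centralizer G S \<noteq> {}"
    using assms by (auto simp: centralizer_def intro!: exI[of _ \<one>])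
next
  fix a assume a: "a \<in> centralizer G S"
  have "inv a \<otimes> s = s \<otimes> inv a" if "s \<in> S" for s
  proof -
    have "s \<in> carrier G" "a \<in> carrier G" "a \<otimes> s = s \<otimes> a"
      using a that assms by (auto simp: centralizer_def)
    then show ?thesis
      by (metis inv_closed inv_solve_left inv_solve_right m_assoc m_closed)
  qed
  then show "inv a \<in> centralizer G S"
    using a by (auto simp: centralizer_def)
next
  fix a b assume ab: "a \<in> centralizer G S" "b \<in> centralizer G S"
  have "a \<otimes> b \<otimes> s = s \<otimes> (a \<otimes> b)" if "s \<in> S" for s
  proof -
    have "s \<in> carrier G" "a \<in> carrier G" "b \<in> carrier G" "a \<otimes> s = s \<otimes> a" "b \<otimes> s = s \<otimes> b"
      using ab that assms by (auto simp: centralizer_def)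
    then show ?thesis
      by (metis m_assoc)
  qed
  then show "a \<otimes> b \<in> centralizer G S"
    using ab by (auto simp: centralizer_def)
qed (auto simp: centralizer_def)

lemma center_eq_centralizer_carrier: "center G = centralizer G (carrier G)"
  by (simp add: center_def centralizer_def)

text \<open>Whatever commutes with all of \<open>C {g}\<close> commutes with \<open>g\<close>, hence already lies in \<open>C {g}\<close>.\<close>

lemma center_element_centralizer:
  assumes "g \<in> carrier G"
  shows "center (G\<lparr>carrier := centralizer G {g}\<rparr>) = centralizer G (centralizer G {g})"
  using assms by (auto simp: center_def centralizer_def)

lemma element_centralizer_centers_eq:
  "element_centralizer_centers G = (\<lambda>g. centralizer G (centralizer G {g})) ` carrier G"
  unfolding element_centralizer_centers_def Setcompr_eq_image
  by (rule image_cong) (auto simp: center_element_centralizer)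

text \<open>The closure of \<open>g\<close> is the least closed set containing \<open>g\<close>, so the elements of a closed set are
  classified by the members of the poset inside it.\<close>

lemma card_centralizer_by_closures:
  assumes fin: "finite (carrier G)" and S: "S \<subseteq> carrier G"
  shows "card (centralizer G S) =
    (\<Sum>Y\<in>{Y \<in> element_centralizer_centers G. Y \<subseteq> centralizer G S}.
       card {g \<in> carrier G. centralizer G (centralizer G {g}) = Y})"
proof -
  let ?cl = "\<lambda>g. centralizer G (centralizer G {g})"
  let ?P = "{Y \<in> element_centralizer_centers G. Y \<subseteq> centralizer G S}"
  have closure_subset_iff: "?cl g \<subseteq> centralizer G S \<longleftrightarrow> g \<in> centralizer G S"
    if g: "g \<in> carrier G" for g
  proof
    assume "?cl g \<subseteq> centralizer G S"
    then show "g \<in> centralizer G S"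
      using subset_double_centralizer[of "{g}" G] g by auto
  next
    assume "g \<in> centralizer G S"
    then have "?cl g \<subseteq> centralizer G (centralizer G (centralizer G S))"
      by (intro centralizer_antimono) simp
    then show "?cl g \<subseteq> centralizer G S"
      using triple_centralizer[OF S] by simp
  qed
  have "centralizer G S = (\<Union>Y\<in>?P. {g \<in> carrier G. ?cl g = Y})"
    using closure_subset_iff centralizer_subset_carrier[of G S]
    by (auto simp: element_centralizer_centers_eq)
  moreover have "card (\<Union>Y\<in>?P. {g \<in> carrier G. ?cl g = Y}) =
      (\<Sum>Y\<in>?P. card {g \<in> carrier G. ?cl g = Y})"
    using fin by (intro card_UN_disjoint) (auto simp: element_centralizer_centers_eq)
  ultimately show ?thesis
    by simp
qed

text \<open>On centralizers \<open>C\<close> is an order-reversing involution; it exchanges the element centralizers with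
  their centres and \<open>G\<close> with its centre.\<close>

lemma sum_element_centralizers_reindex:
  assumes H: "H \<in> centralizer_lattice G"
  shows "(\<Sum>K\<in>{K \<in> element_centralizers G. H \<subseteq> K \<and> K \<subset> carrier G}.
            h (center (G\<lparr>carrier := K\<rparr>))) =
         (\<Sum>Y\<in>{Y \<in> element_centralizer_centers G. Y \<subseteq> centralizer G H} - {center G}. h Y)"
proof (rule sum.reindex_bij_witness[where i = "centralizer G" and j = "centralizer G"])
  have carrier_centralizer: "centralizer G (center G) = carrier G"
    by (auto simp: centralizer_def center_def)
  fix K assume "K \<in> {K \<in> element_centralizers G. H \<subseteq> K \<and> K \<subset> carrier G}"
  then obtain g where g: "g \<in> carrier G" "K = centralizer G {g}" and K: "H \<subseteq> K" "K \<subset> carrier G"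
    by (auto simp: element_centralizers_def)
  show KK: "centralizer G (centralizer G K) = K"
    using triple_centralizer[of "{g}" G] g by simp
  have "centralizer G K \<noteq> center G"
    using KK K(2) carrier_centralizer by auto
  then show "centralizer G K \<in>
      {Y \<in> element_centralizer_centers G. Y \<subseteq> centralizer G H} - {center G}"
    using g centralizer_antimono[OF K(1), of G]
    by (auto simp: element_centralizer_centers_eq)
  show "h (centralizer G K) = h (center (G\<lparr>carrier := K\<rparr>))"
    using center_element_centralizer[OF g(1)] g(2) by simp
next
  obtain S where S: "S \<subseteq> carrier G" "H = centralizer G S"
    using H by (auto simp: centralizer_lattice_def)
  have HH: "centralizer G (centralizer G H) = H"
    using triple_centralizer S by blast
  fix Y assume Y: "Y \<in> {Y \<in> element_centralizer_centers G. Y \<subseteq> centralizer G H} - {center G}"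
  then obtain g where g: "g \<in> carrier G" "Y = centralizer G (centralizer G {g})"
    by (auto simp: element_centralizer_centers_eq)
  have CY: "centralizer G Y = centralizer G {g}"
    using triple_centralizer[of "{g}" G] g by simp
  show YY: "centralizer G (centralizer G Y) = Y"
    using CY g by simp
  have "centralizer G Y \<noteq> carrier G"
    using YY Y center_eq_centralizer_carrier[of G] by auto
  moreover have "H \<subseteq> centralizer G Y"
    using Y HH centralizer_antimono[of Y "centralizer G H" G] by auto
  ultimately show "centralizer G Y \<in> {K \<in> element_centralizers G. H \<subseteq> K \<and> K \<subset> carrier G}"
    using CY g(1) centralizer_subset_carrier[of G Y] by (auto simp: element_centralizers_def)
qed

theorem theorem1:
  fixes p n :: nat and G :: "('a, 'b) monoid_scheme" and H :: "'a set"
  assumes "Factorial_Ring.prime p"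
    and "group G" and "finite (carrier G)" and "order G = p ^ n"
    and "\<not> comm_group G"
    and "H \<in> centralizer_lattice G - {carrier G}"
  shows "[(\<Sum>K\<in>{K \<in> element_centralizers G. H \<subseteq> K \<and> K \<subset> carrier G}.
             moebius (element_centralizer_centers G) (center (G\<lparr>carrier := K\<rparr>))) = - 1] (mod int p)"
proof -
  interpret group G by (rule assms(2))
  let ?P = "element_centralizer_centers G"
  let ?Z = "center G"
  let ?A = "centralizer G H"
  let ?\<mu> = "moebius ?P"
  define z where "z = int (card ?Z)"
  define f where "f Y = int (card {g \<in> carrier G. centralizer G (centralizer G {g}) = Y})" for Y
  have finP: "finite ?P"
    using assms(3) by (simp add: element_centralizer_centers_eq)
  note bottom = center_in_element_centralizer_centers center_least
  have Z_sub: "subgroup ?Z G"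
    by (simp add: center_eq_centralizer_carrier centralizer_subgroup)
  have "0 < z"
    using Z_sub assms(3) subgroup.finite_imp_card_positive unfolding z_def by fastforce
  have card_by_f: "int (card (centralizer G S)) =
      (\<Sum>Y\<in>{Y \<in> ?P. Y \<subseteq> centralizer G S}. f Y)" if "S \<subseteq> carrier G" for S
    using card_centralizer_by_closures[OF assms(3) that] by (simp add: f_def)
  have f_bottom: "f ?Z = z"
  proof -
    have "{Y \<in> ?P. Y \<subseteq> ?Z} = {?Z}"
      using bottom by blast
    then show ?thesis
      using card_by_f[of "carrier G"] by (simp add: z_def flip: center_eq_centralizer_carrier)
  qed
  have sum_f: "[(\<Sum>Y\<in>{Y \<in> ?P. Y \<subseteq> centralizer G S}. f Y) = 0] (mod z * int p)"
    if S: "S \<subseteq> carrier G" and above: "?Z \<noteq> centralizer G S" for S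
  proof -
    have "?Z \<subset> centralizer G S"
      using centralizer_antimono[OF S, of G] above by (auto simp: center_eq_centralizer_carrier)
    then have "p * card ?Z dvd card (centralizer G S)"
      using p_group_proper_subgroup_card_dvd[OF assms(1,3,4) Z_sub centralizer_subgroup[OF S]]
      by simp
    then have "int (p * card ?Z) dvd int (card (centralizer G S))"
      by (simp only: of_nat_dvd_iff)
    then show ?thesis
      using card_by_f[OF S] by (simp add: cong_0_iff z_def mult.commute)
  qed
  have f_moebius: "[f Y = z * ?\<mu> Y] (mod z * int p)" if "Y \<in> ?P" for Y
  proof -
    have "[(\<Sum>W\<in>{W \<in> ?P. W \<subseteq> V}. f W) = 0] (mod z * int p)" if V: "V \<in> ?P" "V \<noteq> ?Z" for V
    proof -
      obtain g where "V = centralizer G (centralizer G {g})"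
        using V(1) unfolding element_centralizer_centers_eq by blast
      then show ?thesis
        using sum_f[OF centralizer_subset_carrier, of "{g}"] V(2) by simp
    qed
    from moebius_cong_counting[OF finP bottom this that] show ?thesis
      by (simp add: f_bottom)
  qed
  have H: "H \<in> centralizer_lattice G" "H \<noteq> carrier G"
    using assms(6) by auto
  then obtain S where S: "S \<subseteq> carrier G" "H = centralizer G S"
    by (auto simp: centralizer_lattice_def)
  then have H_sub: "H \<subseteq> carrier G"
    by (simp add: centralizer_subset_carrier)
  \<comment> \<open>Otherwise \<open>H = C (C H)\<close> would be the centralizer of the centre, which is all of \<open>G\<close>.\<close>
  have A_above: "?Z \<noteq> ?A"
  proof
    assume "?Z = ?A"
    then have "centralizer G ?Z = H"
      using triple_centralizer[OF S(1)] S(2) by simp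
    moreover have "centralizer G ?Z = carrier G"
      by (auto simp: centralizer_def center_def)
    ultimately show False
      using H(2) by simp
  qed
  let ?PA = "{Y \<in> ?P. Y \<subseteq> ?A}"
  have "[(\<Sum>Y\<in>?PA. f Y) = (\<Sum>Y\<in>?PA. z * ?\<mu> Y)] (mod z * int p)"
    by (rule cong_sum) (simp add: f_moebius)
  then have "[z * (\<Sum>Y\<in>?PA. ?\<mu> Y) = 0] (mod z * int p)"
    using sum_f[OF H_sub A_above] unfolding sum_distrib_left
    by (blast intro: cong_trans cong_sym)
  then have "[(\<Sum>Y\<in>?PA. ?\<mu> Y) = 0] (mod int p)"
    using \<open>0 < z\<close> by (simp add: cong_0_iff)
  moreover have "(\<Sum>Y\<in>?PA. ?\<mu> Y) = 1 + (\<Sum>Y\<in>?PA - {?Z}. ?\<mu> Y)"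
  proof -
    have "?Z \<subseteq> ?A"
      using centralizer_antimono[OF H_sub] by (simp add: center_eq_centralizer_carrier)
    then show ?thesis
      using finP bottom moebius_least[OF finP bottom] by (subst sum.remove[of _ ?Z]) auto
  qed
  ultimately have "[(\<Sum>Y\<in>?PA - {?Z}. ?\<mu> Y) = - 1] (mod int p)"
    by (simp add: cong_iff_dvd_diff algebra_simps)
  then show ?thesis
    by (simp only: sum_element_centralizers_reindex[OF H(1)])
qed

end
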